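(* Let $\{E_1,E_2,\ldots,E_k\}$ be a complete orthogonal symmetric idempotent (COSI) set of complex $n\times n$ matrices. Let $G$ be the $k\times k$ block matrix $$G=\begin{pmatrix} E_{11} & E_{12} & \cdots & E_{1k}\\ E_{21} & E_{22} & \cdots & E_{2k}\\ \vdots & \vdots & & \vdots\\ E_{k1} & E_{k2} & \cdots & E_{kk}\end{pmatrix}$$ in which every block $E_{ij}$ belongs to $\{E_1,\ldots,E_k\}$ and each $E_j$ ($1\le j\le k$) appears exactly once in each block row and exactly once in each block column. Then $G$ is a unitary $nk\times nk$ matrix.
   Context: For a complex matrix $A$, $A^*$ denotes the complex conjugate transpose. A square matrix $A$ is unitary if $AA^*=I$. A matrix $E$ is idempotent if $E^2=E$, and symmetric if $E^*=E$. A complete orthogonal symmetric idempotent (COSI) set of $n\times n$ matrices is a set $\{E_1,\ldots,E_k\}$ of $n\times n$ symmetric idempotents such that $E_iE_j=0$ for $i\neq j$ and $E_1+E_2+\cdots+E_k=I_n$. *)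

theory Defs
  imports "HOL-Analysis.Analysis"
begin

definition conj_transpose :: "complex^'n^'m \<Rightarrow> complex^'m^'n" where
  "conj_transpose A = (\<chi> i j. cnj (A $ j $ i))"

definition unitary_matrix :: "complex^'n^'n \<Rightarrow> bool" where
  "unitary_matrix A \<longleftrightarrow> A ** conj_transpose A = mat 1"

definition idempotent_matrix :: "complex^'n^'n \<Rightarrow> bool" where
  "idempotent_matrix A \<longleftrightarrow> A ** A = A"

text \<open>Symmetric here refers to the conjugate transpose, not to the plain transpose.\<close>

definition symmetric_matrix :: "complex^'n^'n \<Rightarrow> bool" where
  "symmetric_matrix A \<longleftrightarrow> conj_transpose A = A"

text \<open>The set \<open>{E\<^sub>1, \<dots>, E\<^sub>k}\<close> is given by its enumeration
  \<open>E\<close>, indexed by a finite type with \<open>k\<close> elements.\<close>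

definition COSI :: "('k::finite \<Rightarrow> complex^'n^'n) \<Rightarrow> bool" where
  "COSI E \<longleftrightarrow>
     (\<forall>i. symmetric_matrix (E i) \<and> idempotent_matrix (E i)) \<and>
     (\<forall>i j. i \<noteq> j \<longrightarrow> E i ** E j = 0) \<and>
     (\<Sum>i\<in>UNIV. E i) = mat 1"

text \<open>A row or column index of the block matrix is a pair consisting of the block index and the
  position inside that block, so that the size is \<open>CARD('k \<times> 'n) = k n\<close>.\<close>

definition block_matrix :: "('k::finite \<Rightarrow> 'k \<Rightarrow> complex^'n^'n) \<Rightarrow> complex^('k \<times> 'n)^('k \<times> 'n)" where
  "block_matrix B = (\<chi> r c. B (fst r) (fst c) $ snd r $ snd c)"

end

theory Submission
  imports Defs
begin

text \<open>
  Multiplication, conjugate transposition and the identity are all computed blockwise, so block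
  \<open>(i, j)\<close> of \<open>G G\<^sup>*\<close> is \<open>\<Sum>\<^sub>l B\<^sub>i\<^sub>l B\<^sub>j\<^sub>l\<^sup>* = \<Sum>\<^sub>l B\<^sub>i\<^sub>l B\<^sub>j\<^sub>l\<close>,
  the blocks being symmetric. For \<open>i \<noteq> j\<close> no column repeats a block, so \<open>B\<^sub>i\<^sub>l\<close> and \<open>B\<^sub>j\<^sub>l\<close>
  are different members of the COSI set and every summand vanishes by orthogonality. For \<open>i = j\<close>
  idempotence turns the sum into \<open>\<Sum>\<^sub>l B\<^sub>i\<^sub>l\<close>; as row \<open>i\<close> is a rearrangement of the COSI set,
  completeness gives the identity.
\<close>

lemma block_matrix_mult:
  fixes A B :: "'k::finite \<Rightarrow> 'k \<Rightarrow> complex^'n^'n"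
  shows "block_matrix A ** block_matrix B = block_matrix (\<lambda>i j. \<Sum>l\<in>UNIV. A i l ** B l j)"
  by (simp add: block_matrix_def matrix_matrix_mult_def vec_eq_iff sum.cartesian_product
      flip: UNIV_Times_UNIV) (simp add: case_prod_unfold)

lemma conj_transpose_block_matrix:
  "conj_transpose (block_matrix B) = block_matrix (\<lambda>i j. conj_transpose (B j i))"
  by (simp add: block_matrix_def conj_transpose_def vec_eq_iff)

lemma block_matrix_identity:
  "block_matrix (\<lambda>i j. if i = j then mat 1 else 0) = mat 1"
  by (auto simp: block_matrix_def mat_def vec_eq_iff)

text \<open>
  Choosing for each \<open>l\<close> an index \<open>p l\<close> with \<open>F l = E (p l)\<close> gives a self-map of a finite type;
  it inherits injectivity from \<open>F\<close>, so it is a permutation and reindexes the sum.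
\<close>

lemma sum_rearrangement:
  fixes E F :: "'k::finite \<Rightarrow> 'a::comm_monoid_add"
  assumes "range F \<subseteq> range E" and "inj F"
  shows "(\<Sum>l\<in>UNIV. F l) = (\<Sum>l\<in>UNIV. E l)"
proof -
  have "\<forall>l. \<exists>a. F l = E a"
    using assms(1) by blast
  then obtain p where p: "\<And>l. F l = E (p l)"
    by metis
  have "inj p"
    using assms(2) by (auto simp: inj_def p)
  then have "bij p"
    by (simp add: bij_def finite_UNIV_inj_surj)
  then show ?thesis
    by (simp add: p sum.reindex_bij_betw)
qed

theorem proposition2p1:
  fixes E :: "'k::finite \<Rightarrow> complex^'n^'n"
    and B :: "'k \<Rightarrow> 'k \<Rightarrow> complex^'n^'n"
  assumes "COSI E"
    and "\<And>i j. B i j \<in> range E"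
    and "\<And>i j. \<exists>!l. B i l = E j"
    and "\<And>i j. \<exists>!l. B l i = E j"
  shows "unitary_matrix (block_matrix B)"
proof -
  have sym: "conj_transpose (B i j) = B i j" and idem: "B i j ** B i j = B i j" for i j
    using assms(1) assms(2)[of i j]
    by (auto simp: COSI_def symmetric_matrix_def idempotent_matrix_def)
  have orth: "B i l ** B j l = 0" if "i \<noteq> j" for i j l
  proof -
    obtain a b where ab: "B i l = E a" "B j l = E b"
      using assms(2) by (meson imageE)
    have "a \<noteq> b"
      using assms(4)[of l a] ab that by metis
    then show ?thesis
      using assms(1) ab by (simp add: COSI_def)
  qed
  have complete: "(\<Sum>l\<in>UNIV. B i l) = mat 1" for i
  proof -
    have "inj (B i)"
      using assms(2,3) by (metis imageE injI)
    then have "(\<Sum>l\<in>UNIV. B i l) = (\<Sum>l\<in>UNIV. E l)"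
      using assms(2) by (intro sum_rearrangement) auto
    then show ?thesis
      using assms(1) by (simp add: COSI_def)
  qed
  have "(\<Sum>l\<in>UNIV. B i l ** conj_transpose (B j l)) = (if i = j then mat 1 else 0)" for i j
    by (simp add: sym idem orth complete)
  then show ?thesis
    by (simp add: unitary_matrix_def conj_transpose_block_matrix block_matrix_mult
        block_matrix_identity)
qed

end
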